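(* Let $H$ be a parity-check matrix of a binary linear code $\mathcal{C}$ of length $n$ such that every row of $H$ has weight $2$ (exactly two nonzero entries). Then: (a) There is an equivalence relation on the set $\mathcal{I}=\{1,\dots,n\}$ of column indices of $H$ such that for every vector $x\in\mathbb{R}^n$ with non-negative coordinates we have $x\in\mathcal{K}(H)$ if and only if $x$ has equal coordinates within each equivalence class. (b) The minimum distance of $\mathcal{C}$ is equal to its minimum AWGNC pseudoweight, its minimum BSC pseudoweight and its minimum max-fractional weight with respect to $H$, i.e. $d(\mathcal{C})=w_{\mathrm{AWGNC}}^{\min}(H)=w_{\mathrm{BSC}}^{\min}(H)=w_{\mathrm{maxfrac}}^{\min}(H)$.
   Context: A binary linear code of length $n\ge 1$ is a linear subspace $\mathcal{C}\subseteq\mathbb{F}_2^n$; $d(\mathcal{C})$ is its minimum Hamming distance. A parity-check matrix of $\mathcal{C}$ is any $m\times n$ matrix $H$ over $\mathbb{F}_2$ (redundant rows allowed) with $\mathcal{C}=\ker H=\{c\in\mathbb{F}_2^n : Hc^T=0\}$. Put $\mathcal{I}=\{1,\dots,n\}$, $\mathcal{J}=\{1,\dots,m\}$, and $\mathcal{I}_j=\{i\in\mathcal{I}: H_{j,i}\ne 0\}$ for $j\in\mathcal{J}$. The fundamental cone $\mathcal{K}(H)$ is the set of $x\in\mathbb{R}^n$ with $x_i\ge 0$ for all $i\in\mathcal{I}$ and $x_\ell\le\sum_{i\in\mathcal{I}_j\setminus\{\ell\}}x_i$ for all $j\in\mathcal{J}$, $\ell\in\mathcal{I}_j$. For nonzero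 $x\in\mathcal{K}(H)$ define: $w_{\mathrm{AWGNC}}(x)=\left(\sum_i x_i\right)^2/\sum_i x_i^2$; $w_{\mathrm{maxfrac}}(x)=\left(\sum_i x_i\right)/\max_i x_i$; and $w_{\mathrm{BSC}}(x)=2\,\Phi^{-1}(\Phi(n)/2)$, where $x'$ is $x$ with its components rearranged in non-increasing order, $\phi(\xi)=x'_i$ for $i-1<\xi\le i$ ($1\le i\le n$), and $\Phi(\xi)=\int_0^\xi\phi(\xi')\,d\xi'$ (i.e. $\Phi^{-1}(\Phi(n)/2)$ is the unique $\xi\in[0,n]$ with $\Phi(\xi)=\Phi(n)/2$). For each type of weight $w$, the minimum pseudoweight is $w^{\min}(H)=\min_{x\in\mathcal{K}(H)\setminus\{0\}}w(x)$. *)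

theory Defs
  imports
    "HOL-Analysis.Henstock_Kurzweil_Integration"
    "HOL-Library.Z2"
    "Jordan_Normal_Form.Matrix_Kernel"
begin

(* The index notation $ below is that of Jordan_Normal_Form vectors. *)
unbundle no vec_syntax

(* Column indices 1, ..., n and row indices 1, ..., m are shifted to {..<n} and {..<m}.
   The field F_2 is the type bit. *)

definition binary_linear_code :: "nat \<Rightarrow> bit Matrix.vec set \<Rightarrow> bool" where
  "binary_linear_code n C \<longleftrightarrow> 1 \<le> n \<and> VectorSpace.subspace class_ring C (module_vec TYPE(bit) n)"

(* m = 0 is allowed: the empty matrix is a parity-check matrix of the full space. *)
definition parity_check_matrix :: "nat \<Rightarrow> nat \<Rightarrow> bit Matrix.mat \<Rightarrow> bit Matrix.vec set \<Rightarrow> bool" where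
  "parity_check_matrix m n H C \<longleftrightarrow> H \<in> carrier_mat m n \<and> C = mat_kernel H"

definition row_support :: "bit Matrix.mat \<Rightarrow> nat \<Rightarrow> nat set" where
  "row_support H j = {i. i < dim_col H \<and> H $$ (j, i) \<noteq> 0}"

definition fundamental_cone :: "bit Matrix.mat \<Rightarrow> real Matrix.vec set" where
  "fundamental_cone H = {x \<in> carrier_vec (dim_col H).
     (\<forall>i<dim_col H. 0 \<le> x $ i) \<and>
     (\<forall>j<dim_row H. \<forall>l\<in>row_support H j. x $ l \<le> (\<Sum>i\<in>row_support H j - {l}. x $ i))}"

(* LEAST is unspecified if the minimum is not attained; has_minimum says that it is. *)
definition has_minimum :: "('a \<Rightarrow> 'b::linorder) \<Rightarrow> 'a set \<Rightarrow> bool" where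
  "has_minimum f S \<longleftrightarrow> (\<exists>x. is_arg_min f (\<lambda>y. y \<in> S) x)"

definition minimum_over :: "('a \<Rightarrow> 'b::linorder) \<Rightarrow> 'a set \<Rightarrow> 'b" where
  "minimum_over f S = (LEAST v. v \<in> f ` S)"

definition hamming_distance :: "'a Matrix.vec \<times> 'a Matrix.vec \<Rightarrow> nat" where
  "hamming_distance p = card {i. i < dim_vec (fst p) \<and> fst p $ i \<noteq> snd p $ i}"

definition distinct_pairs :: "'a set \<Rightarrow> ('a \<times> 'a) set" where
  "distinct_pairs C = {(c, c'). c \<in> C \<and> c' \<in> C \<and> c \<noteq> c'}"

definition min_distance :: "bit Matrix.vec set \<Rightarrow> nat" where
  "min_distance C = minimum_over hamming_distance (distinct_pairs C)"

definition nonzero_pseudocodewords :: "bit Matrix.mat \<Rightarrow> real Matrix.vec set" where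
  "nonzero_pseudocodewords H = fundamental_cone H - {0\<^sub>v (dim_col H)}"

definition min_pseudoweight :: "(real Matrix.vec \<Rightarrow> real) \<Rightarrow> bit Matrix.mat \<Rightarrow> real" where
  "min_pseudoweight w H = minimum_over w (nonzero_pseudocodewords H)"

definition w_AWGNC :: "real Matrix.vec \<Rightarrow> real" where
  "w_AWGNC x = (\<Sum>i<dim_vec x. x $ i)\<^sup>2 / (\<Sum>i<dim_vec x. (x $ i)\<^sup>2)"

definition w_maxfrac :: "real Matrix.vec \<Rightarrow> real" where
  "w_maxfrac x = (\<Sum>i<dim_vec x. x $ i) / Max (set\<^sub>v x)"

definition nonincreasing_rearrangement :: "real Matrix.vec \<Rightarrow> real list" where
  "nonincreasing_rearrangement x = rev (sort (list_of_vec x))"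

(* For i - 1 < \<xi> \<le> i with 1 \<le> i \<le> n, the ceiling of \<xi> is i, and the i-th component has list
   index i - 1. The value at \<xi> = 0 does not affect the integral. *)
definition bsc_phi :: "real Matrix.vec \<Rightarrow> real \<Rightarrow> real" where
  "bsc_phi x \<xi> = nonincreasing_rearrangement x ! (nat \<lceil>\<xi>\<rceil> - 1)"

definition bsc_Phi :: "real Matrix.vec \<Rightarrow> real \<Rightarrow> real" where
  "bsc_Phi x \<xi> = integral {0..\<xi>} (bsc_phi x)"

definition w_BSC :: "real Matrix.vec \<Rightarrow> real" where
  "w_BSC x = 2 * (THE \<xi>. \<xi> \<in> {0..real (dim_vec x)} \<and>
                     bsc_Phi x \<xi> = bsc_Phi x (real (dim_vec x)) / 2)"

end

theory Submission
  imports Defs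
begin

(* The rows of weight 2 say that a codeword, or a point of the fundamental cone, takes equal values
   at the two positions of each row; hence both are described by constancy on the classes of an
   equivalence relation on positions. The support of a nonzero codeword and the set of positions
   where a pseudocodeword x attains its maximum M each contain a class, so with d the least size of
   a class, the code has minimum distance d and x has max-fractional weight at least d. The other
   two weights dominate the max-fractional one: \<Sum>x_i^2 \<le> M \<Sum>x_i for AWGNC, and \<Phi>(\<xi>) \<le> M \<xi> for
   BSC. All weights equal d at the indicator vector of a smallest class. *)

text \<open>One witness and one lower bound settle both attainment and the \<open>LEAST\<close>
  value. Used for the Hamming distance and for each of the three weights.\<close>

lemma minimum_attained:
  assumes "a \<in> S" "f a = v" "\<And>y. y \<in> S \<Longrightarrow> v \<le> f y"
  shows "has_minimum f S" "minimum_over f S = v"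
proof -
  show "has_minimum f S"
    unfolding has_minimum_def is_arg_min_def using assms by (metis leD)
  show "minimum_over f S = v"
    unfolding minimum_over_def by (rule Least_equality) (use assms in auto)
qed

section \<open>Vectors constant on row supports\<close>

text \<open>The value type is arbitrary so that one notion serves real pseudocodewords, codewords
  over F_2 and predicates on positions.\<close>

definition row_constant :: "bit mat \<Rightarrow> (nat \<Rightarrow> 'a) \<Rightarrow> bool" where
  "row_constant H f \<longleftrightarrow> (\<forall>j<dim_row H. \<forall>a\<in>row_support H j. \<forall>b\<in>row_support H j. f a = f b)"

text \<open>The equivalence relation generated by sharing a row; for rows of weight 2, its classes
  are the connected components of the graph on the columns whose edges are the rows. Quantifying
  over predicates makes the equivalence laws immediate.\<close>

definition row_equivalence :: "bit mat \<Rightarrow> (nat \<times> nat) set" where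
  "row_equivalence H = {(i, k). i < dim_col H \<and> k < dim_col H \<and>
     (\<forall>P :: nat \<Rightarrow> bool. row_constant H P \<longrightarrow> P i = P k)}"

lemma equiv_row_equivalence: "equiv {..<dim_col H} (row_equivalence H)"
  unfolding row_equivalence_def
  by (intro equivI refl_onI symI transI) auto

lemma row_constant_equivalent:
  assumes "row_constant H f" "(i, k) \<in> row_equivalence H"
  shows "f i = f k"
proof -
  \<comment> \<open>The relation tests Boolean predicates only; an \<open>f\<close> with values of
    any type is reduced to the predicate of taking the value \<open>f i\<close>.\<close>
  have "row_constant H (\<lambda>j. f j = f i)"
    using assms(1) unfolding row_constant_def by metis
  moreover have "\<forall>P :: nat \<Rightarrow> bool. row_constant H P \<longrightarrow> P i = P k"
    using assms(2) by (simp add: row_equivalence_def)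
  ultimately have "(f i = f i) = (f k = f i)"
    by (elim allE[of _ "\<lambda>j. f j = f i"] impE)
  then show ?thesis by simp
qed

lemma row_support_equivalent:
  assumes "j < dim_row H" "a \<in> row_support H j" "b \<in> row_support H j"
  shows "(a, b) \<in> row_equivalence H"
  using assms unfolding row_equivalence_def row_constant_def row_support_def by blast

lemma row_constant_iff_classes:
  "row_constant H f \<longleftrightarrow>
     (\<forall>E\<in>{..<dim_col H} // row_equivalence H. \<forall>i\<in>E. \<forall>k\<in>E. f i = f k)"
proof
  assume "row_constant H f"
  then show "\<forall>E\<in>{..<dim_col H} // row_equivalence H. \<forall>i\<in>E. \<forall>k\<in>E. f i = f k"
    using row_constant_equivalent quotient_eq_iff[OF equiv_row_equivalence] by metis
next
  assume *: "\<forall>E\<in>{..<dim_col H} // row_equivalence H. \<forall>i\<in>E. \<forall>k\<in>E. f i = f k"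
  show "row_constant H f"
    unfolding row_constant_def
  proof (intro allI impI ballI)
    fix j a b
    assume "j < dim_row H" "a \<in> row_support H j" "b \<in> row_support H j"
    then have ab: "(a, b) \<in> row_equivalence H"
      by (rule row_support_equivalent)
    then have "a \<in> {..<dim_col H}"
      by (simp add: row_equivalence_def)
    then have "row_equivalence H `` {a} \<in> {..<dim_col H} // row_equivalence H"
      "a \<in> row_equivalence H `` {a}"
      using equiv_class_self[OF equiv_row_equivalence] by (auto intro: quotientI)
    with ab * show "f a = f b" by blast
  qed
qed

text \<open>Row supports lie within the columns, so every lookup is in range. This turns membership
  in a class into a 0/1 vector, over the reals and over F_2.\<close>

lemma row_constant_vec:
  assumes "row_constant H f"
  shows "row_constant H (($) (vec (dim_col H) (\<lambda>i. g (f i))))"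
  unfolding row_constant_def
proof (intro allI impI ballI)
  fix j a b
  assume "j < dim_row H" "a \<in> row_support H j" "b \<in> row_support H j"
  moreover from this have "f a = f b"
    using assms unfolding row_constant_def by blast
  ultimately show "vec (dim_col H) (\<lambda>i. g (f i)) $ a = vec (dim_col H) (\<lambda>i. g (f i)) $ b"
    by (simp add: row_support_def)
qed

text \<open>Distinct classes are disjoint, so E contains either all or none of any class.\<close>

lemma row_constant_indicator:
  assumes "E \<in> {..<dim_col H} // row_equivalence H"
  shows "row_constant H (\<lambda>i. i \<in> E)"
  unfolding row_constant_iff_classes
  using assms quotient_disj[OF equiv_row_equivalence] by blast

text \<open>The class of \<open>i\<close> is the witness. Every nonempty level set is thus at least
  as large as some class, the source of all lower bounds.\<close>

lemma class_subset_row_constant: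
  assumes "row_constant H f" "i < dim_col H"
  shows "\<exists>E\<in>{..<dim_col H} // row_equivalence H. E \<subseteq> {..<dim_col H} \<and> (\<forall>k\<in>E. f k = f i)"
proof (intro bexI conjI ballI)
  show "row_equivalence H `` {i} \<in> {..<dim_col H} // row_equivalence H"
    using assms(2) by (auto intro: quotientI)
  show "row_equivalence H `` {i} \<subseteq> {..<dim_col H}"
    by (auto simp: row_equivalence_def)
  show "f k = f i" if "k \<in> row_equivalence H `` {i}" for k
    using row_constant_equivalent[OF assms(1)] that by fastforce
qed

text \<open>For a row with support {a, b} the two cone inequalities are
  \<open>x $ a \<le> x $ b\<close> and its reverse.\<close>

lemma fundamental_cone_iff_row_constant:
  assumes "\<forall>j<dim_row H. card (row_support H j) = 2"
  shows "x \<in> fundamental_cone H \<longleftrightarrow>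
    x \<in> carrier_vec (dim_col H) \<and> (\<forall>i<dim_col H. 0 \<le> x $ i) \<and> row_constant H (($) x)"
proof -
  have "(\<forall>l\<in>row_support H j. x $ l \<le> (\<Sum>i\<in>row_support H j - {l}. x $ i)) \<longleftrightarrow>
      (\<forall>a\<in>row_support H j. \<forall>b\<in>row_support H j. x $ a = x $ b)" if "j < dim_row H" for j
  proof -
    obtain a b where "row_support H j = {a, b}" "a \<noteq> b"
      using assms \<open>j < dim_row H\<close> by (meson card_2_iff)
    then show ?thesis
      by (auto simp: insert_Diff_if)
  qed
  then show ?thesis
    unfolding fundamental_cone_def row_constant_def by blast
qed

text \<open>A row with support {a, b} gives the check \<open>c $ a + c $ b = 0\<close>, which over
  F_2 means equality.\<close>

lemma mat_kernel_iff_row_constant: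
  assumes "\<forall>j<dim_row H. card (row_support H j) = 2"
  shows "c \<in> mat_kernel H \<longleftrightarrow> c \<in> carrier_vec (dim_col H) \<and> row_constant H (($) c)"
proof (cases "c \<in> carrier_vec (dim_col H)")
  case True
  have "(H *\<^sub>v c) $ j = 0 \<longleftrightarrow>
      (\<forall>a\<in>row_support H j. \<forall>b\<in>row_support H j. c $ a = c $ b)" if "j < dim_row H" for j
  proof -
    obtain a b where ab: "row_support H j = {a, b}" "a \<noteq> b"
      using assms \<open>j < dim_row H\<close> by (meson card_2_iff)
    have "(H *\<^sub>v c) $ j = (\<Sum>i<dim_col H. H $$ (j, i) * c $ i)"
      using True \<open>j < dim_row H\<close> by (auto simp: scalar_prod_def atLeast0LessThan)
    also have "\<dots> = (\<Sum>i\<in>row_support H j. H $$ (j, i) * c $ i)"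
      by (rule sum.mono_neutral_right) (auto simp: row_support_def)
    \<comment> \<open>A nonzero entry over F_2 is 1.\<close>
    also have "\<dots> = (\<Sum>i\<in>row_support H j. c $ i)"
      by (rule sum.cong) (auto simp: row_support_def)
    also have "\<dots> = c $ a + c $ b"
      using ab by simp
    finally show ?thesis
      using ab by (cases "c $ a"; cases "c $ b") auto
  qed
  then show ?thesis
    using True unfolding mat_kernel_def row_constant_def by (auto simp: vec_eq_iff)
qed (simp add: mat_kernel_def)

section \<open>Comparison of the weights\<close>

lemma sum_vec_pos:
  fixes x :: "real vec"
  assumes "\<And>i. i < dim_vec x \<Longrightarrow> 0 \<le> x $ i" "x \<noteq> 0\<^sub>v (dim_vec x)"
  shows "0 < (\<Sum>i<dim_vec x. x $ i)"
proof -
  obtain k where "k < dim_vec x" "x $ k \<noteq> 0"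
    using assms(2) by (auto simp: vec_eq_iff)
  then show ?thesis
    using assms(1) by (intro sum_pos2[of _ k]) (auto simp: less_le)
qed

lemma Max_vec_pos:
  fixes x :: "real vec"
  assumes "\<And>i. i < dim_vec x \<Longrightarrow> 0 \<le> x $ i" "x \<noteq> 0\<^sub>v (dim_vec x)"
  shows "0 < Max (set\<^sub>v x)"
proof -
  obtain k where "k < dim_vec x" "x $ k > 0"
    using assms by (force simp: vec_eq_iff less_le)
  then show ?thesis
    by (subst Max_gr_iff) (auto simp: vec_set_def)
qed

lemma le_Max_vec:
  fixes x :: "real vec"
  shows "i < dim_vec x \<Longrightarrow> x $ i \<le> Max (set\<^sub>v x)"
  by (rule Max_ge) (auto simp: vec_set_def)

lemma w_maxfrac_le_w_AWGNC:
  assumes nn: "\<And>i. i < dim_vec x \<Longrightarrow> 0 \<le> x $ i" and nz: "x \<noteq> 0\<^sub>v (dim_vec x)"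
  shows "w_maxfrac x \<le> w_AWGNC x"
proof -
  let ?s = "\<Sum>i<dim_vec x. x $ i" and ?q = "\<Sum>i<dim_vec x. (x $ i)\<^sup>2" and ?M = "Max (set\<^sub>v x)"
  have s: "?s > 0" and M: "?M > 0"
    using sum_vec_pos[OF nn nz] Max_vec_pos[OF nn nz] by auto
  obtain k where "k < dim_vec x" "x $ k \<noteq> 0"
    using nz by (auto simp: vec_eq_iff)
  then have q: "?q > 0"
    by (intro sum_pos2[of _ k]) auto
  have "?q \<le> (\<Sum>i<dim_vec x. ?M * x $ i)"
    unfolding power2_eq_square by (intro sum_mono mult_right_mono) (auto simp: le_Max_vec nn)
  \<comment> \<open>Division by \<open>?M * ?q\<close> turns this into
    \<open>?s / ?M \<le> ?s^2 / ?q\<close>.\<close>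
  then have "?s * ?q \<le> ?s * (?M * ?s)"
    using s by (intro mult_left_mono) (simp_all flip: sum_distrib_left)
  then show ?thesis
    unfolding w_maxfrac_def w_AWGNC_def using M q
    by (simp add: divide_simps power2_eq_square ac_simps)
qed

section \<open>The rearrangement, the step function \<phi> and its integral \<Phi>\<close>

lemma length_nonincreasing_rearrangement [simp]:
  "length (nonincreasing_rearrangement x) = dim_vec x"
  by (simp add: nonincreasing_rearrangement_def)

lemma set_nonincreasing_rearrangement: "set (nonincreasing_rearrangement x) = set\<^sub>v x"
  by (simp add: nonincreasing_rearrangement_def set_list_of_vec)

lemma nonincreasing_rearrangement_antimono:
  assumes "i \<le> k" "k < dim_vec x"
  shows "nonincreasing_rearrangement x ! k \<le> nonincreasing_rearrangement x ! i"
  using assms by (intro sorted_rev_nth_mono) (auto simp: nonincreasing_rearrangement_def)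

lemma sum_nonincreasing_rearrangement:
  "(\<Sum>i<dim_vec x. nonincreasing_rearrangement x ! i) = (\<Sum>i<dim_vec x. x $ i)"
proof -
  have "mset (nonincreasing_rearrangement x) = mset (list_of_vec x)"
    by (simp add: nonincreasing_rearrangement_def)
  then have "sum_list (nonincreasing_rearrangement x) = sum_list (list_of_vec x)"
    by (metis sum_mset_sum_list)
  then show ?thesis
    by (simp add: sum_list_sum_nth atLeast0LessThan)
qed

text \<open>For \<xi> \<le> 0 the truncations by \<open>nat\<close> and by natural subtraction give
  index 0, which is in range because the dimension is positive.\<close>

lemma bsc_phi_in_vec_set:
  fixes \<xi> :: real
  assumes "0 < dim_vec x" "\<xi> \<le> dim_vec x"
  shows "bsc_phi x \<xi> \<in> set\<^sub>v x"
proof -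
  have "nat \<lceil>\<xi>\<rceil> - 1 < dim_vec x"
    using assms by linarith
  then show ?thesis
    unfolding bsc_phi_def set_nonincreasing_rearrangement[symmetric] by (intro nth_mem) simp
qed

lemma bsc_phi_antimono:
  fixes \<xi> \<zeta> :: real
  assumes "0 < dim_vec x" "\<xi> \<le> \<zeta>" "\<zeta> \<le> dim_vec x"
  shows "bsc_phi x \<zeta> \<le> bsc_phi x \<xi>"
proof -
  have "nat \<lceil>\<zeta>\<rceil> - 1 < dim_vec x" "nat \<lceil>\<xi>\<rceil> - 1 \<le> nat \<lceil>\<zeta>\<rceil> - 1"
    using assms ceiling_mono[of \<xi> \<zeta>] by linarith+
  then show ?thesis
    unfolding bsc_phi_def by (intro nonincreasing_rearrangement_antimono)
qed

text \<open>Induction adds one unit interval at a time. For k beyond the dimension \<open>!\<close>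
  is unspecified, but both sides read the same entries, so \<phi> is integrable on every bounded
  interval of nonnegative reals.\<close>

lemma bsc_phi_has_integral:
  "(bsc_phi x has_integral (\<Sum>i<k. nonincreasing_rearrangement x ! i)) {0..real k}"
proof (induction k)
  case 0
  show ?case by (simp add: has_integral_refl)
next
  case (Suc k)
  let ?c = "nonincreasing_rearrangement x ! k"
  have "((\<lambda>_. ?c) has_integral ?c) {real k..real (Suc k)}"
    using has_integral_const_real[of ?c "real k" "real (Suc k)"] by simp
  \<comment> \<open>At the left end point \<phi> may still have the preceding entry as its value; a
    single point does not affect the integral.\<close>
  then have "(bsc_phi x has_integral ?c) {real k..real (Suc k)}"
  proof (rule has_integral_spike_finite[of "{real k}", rotated 2])
    fix \<xi> assume "\<xi> \<in> {real k..real (Suc k)} - {real k}"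
    then have "\<lceil>\<xi>\<rceil> = int k + 1"
      by (intro ceiling_unique) auto
    then show "bsc_phi x \<xi> = ?c"
      by (simp add: bsc_phi_def nat_add_distrib)
  qed simp
  then show ?case
    using has_integral_combine[OF _ _ Suc] by fastforce
qed

lemma bsc_phi_integrable:
  assumes "0 \<le> a"
  shows "bsc_phi x integrable_on {a..b}"
proof (rule integrable_on_subinterval)
  show "bsc_phi x integrable_on {0..real (nat \<lceil>b\<rceil>)}"
    using bsc_phi_has_integral by blast
  show "{a..b} \<subseteq> {0..real (nat \<lceil>b\<rceil>)}"
    using assms real_nat_ceiling_ge[of b] by auto
qed

lemma bsc_Phi_diff:
  assumes "0 \<le> a" "a \<le> b"
  shows "bsc_Phi x b - bsc_Phi x a = integral {a..b} (bsc_phi x)"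
  unfolding bsc_Phi_def
  using Henstock_Kurzweil_Integration.integral_combine[of 0 a b "bsc_phi x"] assms
  by (simp add: bsc_phi_integrable)

text \<open>The only estimate of \<Phi> used below: for uniqueness of the half point, for
  \<Phi>(\<xi>) \<le> M \<xi>, and, with l = u, for an exact value.\<close>

lemma bsc_Phi_diff_bounds:
  assumes "0 \<le> a" "a \<le> b" "\<And>\<xi>. a \<le> \<xi> \<Longrightarrow> \<xi> \<le> b \<Longrightarrow> l \<le> bsc_phi x \<xi> \<and> bsc_phi x \<xi> \<le> u"
  shows "(b - a) * l \<le> bsc_Phi x b - bsc_Phi x a" "bsc_Phi x b - bsc_Phi x a \<le> (b - a) * u"
proof -
  have "integral {a..b} (\<lambda>_. l) \<le> integral {a..b} (bsc_phi x)"
    "integral {a..b} (bsc_phi x) \<le> integral {a..b} (\<lambda>_. u)"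
    using assms by (intro integral_le bsc_phi_integrable; simp add: integrable_const_ivl)+
  then show "(b - a) * l \<le> bsc_Phi x b - bsc_Phi x a"
    "bsc_Phi x b - bsc_Phi x a \<le> (b - a) * u"
    using assms(1,2) by (auto simp: bsc_Phi_diff)
qed

lemma bsc_Phi_0 [simp]: "bsc_Phi x 0 = 0"
  by (simp add: bsc_Phi_def)

lemma bsc_Phi_nat: "bsc_Phi x (real k) = (\<Sum>i<k. nonincreasing_rearrangement x ! i)"
  unfolding bsc_Phi_def by (rule integral_unique[OF bsc_phi_has_integral])

lemma bsc_Phi_dim: "bsc_Phi x (real (dim_vec x)) = (\<Sum>i<dim_vec x. x $ i)"
  by (simp add: bsc_Phi_nat sum_nonincreasing_rearrangement)

(* If \<Phi> took the value \<Phi>(n)/2 at a < b, then \<phi>(b) = 0, so \<phi> would vanish on [b, n] and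
   \<Phi>(n) = \<Phi>(b) = \<Phi>(n)/2. *)
lemma bsc_Phi_half_unique:
  fixes a b :: real
  assumes nn: "\<And>i. i < dim_vec x \<Longrightarrow> 0 \<le> x $ i" and nz: "x \<noteq> 0\<^sub>v (dim_vec x)"
    and "0 \<le> a" "a < b" "b \<le> dim_vec x"
    and "bsc_Phi x a = bsc_Phi x (dim_vec x) / 2"
  shows "bsc_Phi x b \<noteq> bsc_Phi x (dim_vec x) / 2"
proof
  assume b: "bsc_Phi x b = bsc_Phi x (dim_vec x) / 2"
  have dim: "0 < dim_vec x"
    using nz by (auto simp: vec_eq_iff)
  have "(b - a) * bsc_phi x b \<le> bsc_Phi x b - bsc_Phi x a"
    using assms dim
    by (intro bsc_Phi_diff_bounds[where u = "bsc_phi x a"]) (auto intro!: bsc_phi_antimono)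
  then have "bsc_phi x b \<le> 0"
    using assms b by (simp add: mult_le_0_iff)
  then have "bsc_Phi x (dim_vec x) - bsc_Phi x b \<le> (dim_vec x - b) * 0"
    using assms dim
    by (intro bsc_Phi_diff_bounds[where l = "bsc_phi x (dim_vec x)"])
       (auto intro!: bsc_phi_antimono intro: order_trans[OF bsc_phi_antimono])
  then show False
    using b sum_vec_pos[OF nn nz] by (simp add: bsc_Phi_dim)
qed

text \<open>By uniqueness, exhibiting any half point resolves the definite description.\<close>

lemma w_BSC_eqI:
  fixes \<xi> :: real
  assumes "\<And>i. i < dim_vec x \<Longrightarrow> 0 \<le> x $ i" "x \<noteq> 0\<^sub>v (dim_vec x)"
    and "0 \<le> \<xi>" "\<xi> \<le> dim_vec x" "bsc_Phi x \<xi> = bsc_Phi x (dim_vec x) / 2"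
  shows "w_BSC x = 2 * \<xi>"
proof -
  have "(THE \<xi>. \<xi> \<in> {0..real (dim_vec x)} \<and> bsc_Phi x \<xi> = bsc_Phi x (real (dim_vec x)) / 2) = \<xi>"
  proof (rule the_equality)
    fix \<zeta>
    assume "\<zeta> \<in> {0..real (dim_vec x)} \<and> bsc_Phi x \<zeta> = bsc_Phi x (real (dim_vec x)) / 2"
    then show "\<zeta> = \<xi>"
      using bsc_Phi_half_unique[of x \<zeta> \<xi>] bsc_Phi_half_unique[of x \<xi> \<zeta>] assms
      by (cases \<zeta> \<xi> rule: linorder_cases) auto
  qed (use assms in auto)
  then show ?thesis
    unfolding w_BSC_def by simp
qed

lemma w_maxfrac_le_w_BSC:
  assumes nn: "\<And>i. i < dim_vec x \<Longrightarrow> 0 \<le> x $ i" and nz: "x \<noteq> 0\<^sub>v (dim_vec x)"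
  shows "w_maxfrac x \<le> w_BSC x"
proof -
  let ?s = "\<Sum>i<dim_vec x. x $ i" and ?M = "Max (set\<^sub>v x)"
  have s: "?s > 0" and M: "?M > 0"
    using sum_vec_pos[OF nn nz] Max_vec_pos[OF nn nz] by auto
  have dim: "0 < dim_vec x"
    using nz by (auto simp: vec_eq_iff)
  have cont: "continuous_on {0..real (dim_vec x)} (bsc_Phi x)"
    unfolding bsc_Phi_def
    by (intro indefinite_integral_continuous_1 bsc_phi_integrable) simp
  \<comment> \<open>\<Phi> is continuous and goes from 0 to \<open>?s\<close>, so it passes through
    \<open>?s / 2\<close>.\<close>
  have "\<exists>\<xi>\<ge>0. \<xi> \<le> real (dim_vec x) \<and> bsc_Phi x \<xi> = ?s / 2"
    using s cont by (intro IVT') (auto simp: bsc_Phi_dim)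
  then obtain \<xi> where \<xi>: "0 \<le> \<xi>" "\<xi> \<le> real (dim_vec x)" "bsc_Phi x \<xi> = ?s / 2"
    by blast
  have "bsc_phi x \<zeta> \<in> set\<^sub>v x" if "\<zeta> \<le> \<xi>" for \<zeta>
    using bsc_phi_in_vec_set[OF dim, of \<zeta>] that \<xi> by simp
  then have "bsc_Phi x \<xi> - bsc_Phi x 0 \<le> (\<xi> - 0) * ?M"
    using \<xi>(1) nn
    by (intro bsc_Phi_diff_bounds[where l = 0]) (force simp: vec_set_def intro: Max_ge)+
  \<comment> \<open>At the half point the bound \<Phi>(\<xi>) \<le> M \<xi> reads
    \<open>?s / 2 \<le> \<xi> * ?M\<close>.\<close>
  then have "?s / ?M \<le> 2 * \<xi>"
    using \<xi>(3) M by (simp add: divide_simps ac_simps)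
  also have "2 * \<xi> = w_BSC x"
    using w_BSC_eqI[OF nn nz \<xi>(1,2)] \<xi>(3) by (simp add: bsc_Phi_dim)
  finally show ?thesis
    by (simp add: w_maxfrac_def)
qed

section \<open>Weights of an indicator vector\<close>

context
  fixes n :: nat and E :: "nat set" and x :: "real vec"
  assumes E: "E \<subseteq> {..<n}" "E \<noteq> {}"
  defines "x \<equiv> vec n (\<lambda>i. of_bool (i \<in> E))"
begin

lemma indicator_vec_nonneg: "i < dim_vec x \<Longrightarrow> 0 \<le> x $ i"
  by (simp add: x_def)

lemma indicator_vec_nonzero: "x \<noteq> 0\<^sub>v (dim_vec x)"
  using E by (auto simp: x_def vec_eq_iff)

lemma sum_indicator_vec: "(\<Sum>i<dim_vec x. x $ i) = card E"
  using E by (simp add: x_def Int_absorb2 Int_commute)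

lemma w_maxfrac_indicator: "w_maxfrac x = card E"
proof -
  obtain k where "k \<in> E" "k < n"
    using E by auto
  then have "Max (set\<^sub>v x) = 1"
    by (intro Max_eqI) (force simp: vec_set_def x_def)+
  then show ?thesis
    by (simp add: w_maxfrac_def sum_indicator_vec)
qed

lemma w_AWGNC_indicator: "w_AWGNC x = card E"
proof -
  have "(\<Sum>i<dim_vec x. (x $ i)\<^sup>2) = (\<Sum>i<dim_vec x. x $ i)"
    by (rule sum.cong) (auto simp: x_def)
  then show ?thesis
    by (simp add: w_AWGNC_def sum_indicator_vec power2_eq_square)
qed

text \<open>If entry i were 0, all later ones would be 0 as well, and the entries would sum to at
  most i < |E|; but their sum is |E|.\<close>

lemma rearrangement_indicator:
  assumes "i < card E"
  shows "nonincreasing_rearrangement x ! i = 1"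
proof (rule ccontr)
  let ?r = "nonincreasing_rearrangement x"
  have in01: "?r ! k \<in> {0, 1}" if "k < n" for k
  proof -
    have "?r ! k \<in> set ?r"
      using that by (intro nth_mem) (simp add: x_def)
    then show ?thesis
      by (auto simp: set_nonincreasing_rearrangement vec_set_def x_def)
  qed
  have "card E \<le> n"
    using card_mono[OF _ E(1)] by simp
  then have "i < n"
    using assms by simp
  assume "?r ! i \<noteq> 1"
  then have 0: "?r ! i = 0"
    using in01[OF \<open>i < n\<close>] by simp
  have "?r ! k = 0" if "i \<le> k" "k < n" for k
    using nonincreasing_rearrangement_antimono[of i k x] in01[of k] that 0
    by (auto simp: x_def)
  then have "(\<Sum>k<n. ?r ! k) = (\<Sum>k<i. ?r ! k)"
    using \<open>i < n\<close> by (intro sum.mono_neutral_right) auto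
  also have "\<dots> \<le> (\<Sum>k<i. 1)"
    using in01 \<open>i < n\<close> by (intro sum_mono) (force dest: less_trans)
  finally show False
    using sum_nonincreasing_rearrangement[of x] sum_indicator_vec assms by (simp add: x_def)
qed

text \<open>Since \<phi> is 1 up to |E|/2, \<Phi>(|E|/2) = |E|/2, which is half of \<Phi>(n) =
  |E|.\<close>

lemma w_BSC_indicator: "w_BSC x = card E"
proof -
  have le: "card E \<le> n"
    using card_mono[OF _ E(1)] by simp
  have pos: "0 < card E"
    using E by (simp add: card_gt_0_iff finite_subset[OF E(1)])
  have one: "bsc_phi x \<xi> = 1" if "\<xi> \<le> card E / 2" for \<xi>
  proof -
    have "nat \<lceil>\<xi>\<rceil> - 1 < card E"
      using that pos by linarith
    then show ?thesis
      unfolding bsc_phi_def by (rule rearrangement_indicator)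
  qed
  have "bsc_Phi x (card E / 2) - bsc_Phi x 0 = card E / 2"
    using bsc_Phi_diff_bounds[of 0 "card E / 2" 1 x 1] one by simp
  then have "bsc_Phi x (card E / 2) = bsc_Phi x (dim_vec x) / 2"
    by (simp add: bsc_Phi_dim sum_indicator_vec)
  then have "w_BSC x = 2 * (real (card E) / 2)"
    using le
    by (intro w_BSC_eqI indicator_vec_nonneg indicator_vec_nonzero) (auto simp: x_def)
  then show ?thesis by simp
qed

end

section \<open>The minimum weights\<close>

theorem lemma4p1:
  fixes n m :: nat and C :: "bit Matrix.vec set" and H :: "bit Matrix.mat"
  assumes "binary_linear_code n C"
    and "parity_check_matrix m n H C"
    and "\<forall>j<m. card (row_support H j) = 2"
  shows "(\<exists>R. equiv {..<n} R \<and>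
            (\<forall>x\<in>carrier_vec n. (\<forall>i<n. 0 \<le> x $ i) \<longrightarrow>
               (x \<in> fundamental_cone H \<longleftrightarrow>
                  (\<forall>E\<in>{..<n} // R. \<forall>i\<in>E. \<forall>k\<in>E. x $ i = x $ k)))) \<and>
         (has_minimum hamming_distance (distinct_pairs C) \<and>
          has_minimum w_AWGNC (nonzero_pseudocodewords H) \<and>
          has_minimum w_BSC (nonzero_pseudocodewords H) \<and>
          has_minimum w_maxfrac (nonzero_pseudocodewords H) \<and>
          real (min_distance C) = min_pseudoweight w_AWGNC H \<and>
          min_pseudoweight w_AWGNC H = min_pseudoweight w_BSC H \<and>
          min_pseudoweight w_BSC H = min_pseudoweight w_maxfrac H)"
proof
  have dims [simp]: "dim_col H = n" "dim_row H = m" and C: "C = mat_kernel H"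
    using assms(2) by (auto simp: parity_check_matrix_def)
  have "1 \<le> n"
    using assms(1) by (simp add: binary_linear_code_def)
  have two: "\<forall>j<dim_row H. card (row_support H j) = 2"
    using assms(3) by simp
  note cone = fundamental_cone_iff_row_constant[OF two]
  note kernel = mat_kernel_iff_row_constant[OF two]
  let ?R = "row_equivalence H"
  let ?Q = "{..<n} // ?R"
  show "\<exists>R. equiv {..<n} R \<and> (\<forall>x\<in>carrier_vec n. (\<forall>i<n. 0 \<le> x $ i) \<longrightarrow>
      (x \<in> fundamental_cone H \<longleftrightarrow> (\<forall>E\<in>{..<n} // R. \<forall>i\<in>E. \<forall>k\<in>E. x $ i = x $ k)))"
    using equiv_row_equivalence[of H]
    by (intro exI[of _ ?R]) (simp add: cone row_constant_iff_classes)
  have equivR: "equiv {..<n} ?R"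
    using equiv_row_equivalence[of H] by simp
  \<comment> \<open>As n is positive there is a class, hence a smallest one, E; its size is the
    common value of the four minima.\<close>
  have "finite ?Q" "?Q \<noteq> {}"
    using \<open>1 \<le> n\<close>
    by (auto simp: quotient_is_empty lessThan_empty_iff row_equivalence_def intro!: finite_quotient)
  then obtain E where E: "E \<in> ?Q" and least: "\<And>F. F \<in> ?Q \<Longrightarrow> card E \<le> card F"
    by (metis arg_min_if_finite(1) arg_min_least)
  have Esub: "E \<subseteq> {..<n}" and Ene: "E \<noteq> {}"
    using E equivR by (auto dest: in_quotient_imp_subset in_quotient_imp_non_empty)
  \<comment> \<open>Polymorphic in the values of \<open>f\<close>: used for a pseudocodeword at a
    maximal coordinate and for the agreement predicate of two codewords.\<close>
  have large: "card E \<le> card {k. k < n \<and> f k = f i}"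
    if row: "row_constant H f" and i: "i < n"
    for f :: "nat \<Rightarrow> 'b" and i
  proof -
    obtain F where "F \<in> ?Q" "F \<subseteq> {..<n}" "\<forall>k\<in>F. f k = f i"
      using class_subset_row_constant[OF row, of i] i by auto
    then have "card F \<le> card {k. k < n \<and> f k = f i}"
      by (intro card_mono) auto
    then show ?thesis
      using least[OF \<open>F \<in> ?Q\<close>] by linarith
  qed
  have rowE: "row_constant H (\<lambda>i. i \<in> E)"
    using row_constant_indicator[of E H] E by simp

  define x :: "real vec" where "x = vec n (\<lambda>i. of_bool (i \<in> E))"
  have "row_constant H (($) x)"
    using row_constant_vec[OF rowE, of of_bool] by (simp add: x_def)
  then have x: "x \<in> nonzero_pseudocodewords H"
    using indicator_vec_nonzero[OF Esub Ene]
    by (auto simp: nonzero_pseudocodewords_def cone x_def)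
  have lower: "card E \<le> w_maxfrac y" "card E \<le> w_AWGNC y" "card E \<le> w_BSC y"
    if "y \<in> nonzero_pseudocodewords H" for y
  proof -
    have dim [simp]: "dim_vec y = n" and nn: "\<And>i. i < dim_vec y \<Longrightarrow> 0 \<le> y $ i"
      and nz: "y \<noteq> 0\<^sub>v (dim_vec y)" and row: "row_constant H (($) y)"
      using that by (auto simp: nonzero_pseudocodewords_def cone)
    let ?M = "Max (set\<^sub>v y)"
    have "?M \<in> set\<^sub>v y"
      using \<open>1 \<le> n\<close> by (intro Max_in) (auto simp: vec_set_def lessThan_empty_iff)
    then obtain i where i: "i < n" "y $ i = ?M"
      by (auto simp: vec_set_def)
    \<comment> \<open>At least |E| positions carry the maximum, and the other coordinates are
      nonnegative, so the coordinate sum is at least |E| times the maximum.\<close>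
    have "real (card E) * ?M \<le> real (card {k. k < n \<and> y $ k = y $ i}) * ?M"
      using large[OF row i(1)] Max_vec_pos[OF nn nz] by (intro mult_right_mono) auto
    also have "\<dots> = (\<Sum>k\<in>{k. k < n \<and> y $ k = y $ i}. y $ k)"
      using i by simp
    also have "\<dots> \<le> (\<Sum>k<n. y $ k)"
      using nn by (intro sum_mono2) auto
    finally show "card E \<le> w_maxfrac y"
      using Max_vec_pos[OF nn nz] by (simp add: w_maxfrac_def pos_le_divide_eq)
    then show "card E \<le> w_AWGNC y" "card E \<le> w_BSC y"
      using w_maxfrac_le_w_AWGNC[OF nn nz] w_maxfrac_le_w_BSC[OF nn nz] by linarith+
  qed
  note weight_minima =
    minimum_attained[where f = w_AWGNC, OF x w_AWGNC_indicator[OF Esub Ene, folded x_def] lower(2)]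
    minimum_attained[where f = w_BSC, OF x w_BSC_indicator[OF Esub Ene, folded x_def] lower(3)]
    minimum_attained[where f = w_maxfrac, OF x w_maxfrac_indicator[OF Esub Ene, folded x_def] lower(1)]

  \<comment> \<open>The same indicator over F_2; paired with the zero word it attains the distance
    |E|.\<close>
  define c :: "bit vec" where "c = vec n (\<lambda>i. of_bool (i \<in> E))"
  have "row_constant H (($) c)"
    using row_constant_vec[OF rowE, of of_bool] by (simp add: c_def)
  moreover have "row_constant H (($) (0\<^sub>v n :: bit vec))"
    by (auto simp: row_constant_def row_support_def)
  moreover have "c \<noteq> 0\<^sub>v n"
    using Esub Ene by (auto simp: c_def vec_eq_iff)
  ultimately have c: "(c, 0\<^sub>v n) \<in> distinct_pairs C"
    by (simp add: distinct_pairs_def C kernel) (simp add: c_def)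
  have "{i. i < n \<and> i \<in> E} = E"
    using Esub by auto
  then have cE: "hamming_distance (c, 0\<^sub>v n) = card E"
    by (simp add: hamming_distance_def c_def cong: conj_cong)
  have lowerC: "card E \<le> hamming_distance p" if "p \<in> distinct_pairs C" for p
  proof -
    obtain u v where p: "p = (u, v)" and uv: "u \<in> carrier_vec n" "v \<in> carrier_vec n" "u \<noteq> v"
      and row: "row_constant H (($) u)" "row_constant H (($) v)"
      using \<open>p \<in> distinct_pairs C\<close> by (auto simp: distinct_pairs_def C kernel)
    obtain i where "i < n" "u $ i \<noteq> v $ i"
      using uv by (auto simp: vec_eq_iff)
    \<comment> \<open>No difference of codewords is formed: the positions where u and v differ are
      the level set of this predicate at i, so \<open>large\<close> bounds their number.\<close>
    moreover have "row_constant H (\<lambda>k. u $ k = v $ k)"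
      using row unfolding row_constant_def by metis
    ultimately show ?thesis
      using large[of "\<lambda>k. u $ k = v $ k" i] uv(1) by (simp add: p hamming_distance_def)
  qed
  show "has_minimum hamming_distance (distinct_pairs C) \<and>
          has_minimum w_AWGNC (nonzero_pseudocodewords H) \<and>
          has_minimum w_BSC (nonzero_pseudocodewords H) \<and>
          has_minimum w_maxfrac (nonzero_pseudocodewords H) \<and>
          real (min_distance C) = min_pseudoweight w_AWGNC H \<and>
          min_pseudoweight w_AWGNC H = min_pseudoweight w_BSC H \<and>
          min_pseudoweight w_BSC H = min_pseudoweight w_maxfrac H"
    using weight_minima minimum_attained[where f = hamming_distance, OF c cE lowerC]
    by (simp add: min_distance_def min_pseudoweight_def)
qed

end
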